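(* Fix an integer $\bar k\ge2$. The ordered collection $(\mathscr{P},\preceq)$ of penalty arrays satisfying B1 and B2 (defined in the context) has no minimal element; that is, there is no $\mathrm{pen}^*\in\mathscr{P}$ such that $\mathrm{pen}^*\preceq\mathrm{pen}$ for every $\mathrm{pen}\in\mathscr{P}$.
   Context: Write $[\bar k]=\{1,\dots,\bar k\}$. $\mathscr{P}$ denotes the collection of all arrays of real numbers $\mathrm{pen}=\{\mathrm{pen}_{k,n}:k\in[\bar k],n\in\mathbb{N}\}$ that satisfy: B1: for each $k\in[\bar k]$, $\lim_{n\to\infty}\mathrm{pen}_{k,n}=0$; B2: for each $1\le k<l\le\bar k$, $\lim_{n\to\infty}\frac{n}{\log n}\{\mathrm{pen}_{l,n}-\mathrm{pen}_{k,n}\}=\infty$. The domination order: $\mathrm{pen}^{(1)}\preceq\mathrm{pen}^{(2)}$ if and only if there exists $n_0\in\mathbb{N}$ such that $\mathrm{pen}^{(1)}_{k,n}\le\mathrm{pen}^{(2)}_{k,n}$ for all $n\ge n_0$ and all $k\in[\bar k]$. Following the paper, "minimal element" of $(\mathscr{P},\preceq)$ means an element $\mathrm{pen}^*\in\mathscr{P}$ with $\mathrm{pen}^*\preceq\mathrm{pen}$ for each $\mathrm{pen}\in\mathscr{P}$. *)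

theory Defs
  imports Complex_Main
begin

(* An array (pen_{k,n}) is represented as the function (\<lambda>k n. pen k n). Both definitions
   below look only at rows k in {1..kbar}, so values at other k are irrelevant. The terms
   n = 0, 1 (where ln n = 0 and the quotient is 0 by convention) do not affect the limits. *)

definition penalties :: "nat \<Rightarrow> (nat \<Rightarrow> nat \<Rightarrow> real) set" where
  "penalties kbar = {pen.
     (\<forall>k\<in>{1..kbar}. (\<lambda>n. pen k n) \<longlonglongrightarrow> 0) \<and>
     (\<forall>k l. 1 \<le> k \<and> k < l \<and> l \<le> kbar \<longrightarrow>
        filterlim (\<lambda>n. real n / ln (real n) * (pen l n - pen k n)) at_top sequentially)}"

definition pen_dom :: "nat \<Rightarrow> (nat \<Rightarrow> nat \<Rightarrow> real) \<Rightarrow> (nat \<Rightarrow> nat \<Rightarrow> real) \<Rightarrow> bool" where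
  "pen_dom kbar pen1 pen2 \<longleftrightarrow> (\<exists>n0. \<forall>n\<ge>n0. \<forall>k\<in>{1..kbar}. pen1 k n \<le> pen2 k n)"

end

theory Submission
  imports Defs
begin

text \<open>By \<open>penalties_diff_null_sequence\<close>, no admissible array is a lower bound for
  all others: subtracting one positive null sequence from every row keeps B1 and cancels in B2, yet
  the result lies strictly below the original at every n, so domination fails however large the
  threshold.\<close>

text \<open>Condition B2 only sees differences between rows, so lowering all rows of an admissible
  array by one common positive null sequence yields a strictly smaller admissible array.\<close>

lemma penalties_diff_null_sequence:
  assumes "pen \<in> penalties kbar" and "e \<longlonglongrightarrow> 0"
  shows "(\<lambda>k n. pen k n - e n) \<in> penalties kbar"
  using assms tendsto_diff[of "pen _" 0 sequentially e 0]
  unfolding penalties_def by auto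

theorem proposition15:
  fixes kbar :: nat
  assumes "kbar \<ge> 2"
  shows "\<not> (\<exists>pen_star\<in>penalties kbar. \<forall>pen\<in>penalties kbar. pen_dom kbar pen_star pen)"
proof
  assume "\<exists>pen_star\<in>penalties kbar. \<forall>pen\<in>penalties kbar. pen_dom kbar pen_star pen"
  then obtain p where p: "p \<in> penalties kbar"
    and min: "\<And>q. q \<in> penalties kbar \<Longrightarrow> pen_dom kbar p q"
    by blast
  \<comment> \<open>With \<open>Suc n\<close> the shift is positive at every n, including 0, so any
    threshold \<open>n0\<close> gives a contradiction.\<close>
  have "(\<lambda>k n. p k n - inverse (real (Suc n))) \<in> penalties kbar"
    using p LIMSEQ_inverse_real_of_nat by (rule penalties_diff_null_sequence)
  from min[OF this] obtain n0 where
    "\<forall>n\<ge>n0. \<forall>k\<in>{1..kbar}. p k n \<le> p k n - inverse (real (Suc n))"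
    unfolding pen_dom_def by blast
  then have "p 1 n0 \<le> p 1 n0 - inverse (real (Suc n0))"
    using assms by auto
  moreover have "inverse (real (Suc n0)) > 0"
    by simp
  ultimately show False
    by linarith
qed

end
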